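(* Let $\mathbb{Q}^{tr}$ be the field of all totally real algebraic numbers and $h$ the absolute logarithmic Weil height. If $\alpha\in\mathbb{Q}^{tr}$, $\alpha\ne0$, $\alpha\ne\pm1$, then $$h(\alpha)>\tfrac14\log\theta_{31}^{-1}=0.020498\ldots$$
   Context: An algebraic number is totally real if all its Galois conjugates are real. For an algebraic number $\alpha$, $h(\alpha)=\log\mathrm{M}(\alpha)/\deg(\alpha)$, where $\mathrm{M}(\alpha)$ is the Mahler measure of the minimal polynomial of $\alpha$ over $\mathbb{Z}$. $\theta_{31}$ denotes the unique root in $(0,1)$ of $-1+z+z^{31}$. *)

theory Defs
  imports "Berlekamp_Zassenhaus.Mahler_Measure"
begin

(* The minimal polynomial over the integers: being irreducible as an element of Z[X], it is in
   particular primitive; the sign is fixed by the positive leading coefficient.  The description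
   determines a polynomial for algebraic numbers only (see min_int_poly_ex1). *)
definition min_int_poly :: "complex \<Rightarrow> int poly" where
  "min_int_poly \<alpha> =
     (THE p. irreducible p \<and> lead_coeff p > 0 \<and> poly (map_poly of_int p) \<alpha> = 0)"

definition galois_conjugates :: "complex \<Rightarrow> complex set" where
  "galois_conjugates \<alpha> = {z. poly (map_poly of_int (min_int_poly \<alpha>)) z = 0}"

definition Q_tr :: "complex set" where
  "Q_tr = {\<alpha>. algebraic \<alpha> \<and> galois_conjugates \<alpha> \<subseteq> \<real>}"

definition weil_height :: "complex \<Rightarrow> real" where
  "weil_height \<alpha> = ln (mahler_measure (min_int_poly \<alpha>)) / real (degree (min_int_poly \<alpha>))"

definition theta31 :: real where
  "theta31 = (THE z. 0 < z \<and> z < 1 \<and> - 1 + z + z ^ 31 = 0)"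

lemma theta31_ex1: "\<exists>!z::real. 0 < z \<and> z < 1 \<and> - 1 + z + z ^ 31 = 0"
proof -
  have "\<exists>z::real. 0 \<le> z \<and> z \<le> 1 \<and> - 1 + z + z ^ 31 = 0"
    by (rule IVT') (auto intro!: continuous_intros)
  then obtain z :: real where z: "0 \<le> z" "z \<le> 1" "- 1 + z + z ^ 31 = 0" by blast
  moreover have "z \<noteq> 0" "z \<noteq> 1" using z(3) by auto
  moreover have "y = x"
    if "0 < x" "0 < y" "- 1 + x + x ^ 31 = 0" "- 1 + y + y ^ 31 = 0" for x y :: real
  proof (cases x y rule: linorder_cases)
    case less
    with that power_strict_mono[of x y 31] show ?thesis by simp
  next
    case greater
    with that power_strict_mono[of y x 31] show ?thesis by simp
  qed simp
  ultimately show ?thesis by (intro ex1I[of _ z]) auto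
qed

lemma min_int_poly_ex1:
  assumes "algebraic \<alpha>"
  shows "\<exists>!p :: int poly.
    irreducible p \<and> lead_coeff p > 0 \<and> poly (map_poly of_int p) (\<alpha> :: complex) = 0"
proof -
  let ?P = "\<lambda>p :: int poly. p \<noteq> 0 \<and> poly (map_poly of_int p) \<alpha> = 0"
  have hom: "poly (map_poly of_int (a * b)) \<alpha> =
      poly (map_poly of_int a) \<alpha> * poly (map_poly of_int b) \<alpha>" for a b :: "int poly"
    by (simp add: of_int_poly_hom.hom_mult)
  have posdeg: "degree p > 0" if p: "?P p" for p
  proof (rule ccontr)
    assume "\<not> degree p > 0"
    then obtain c where "p = [:c:]" using degree_eq_zeroE by blast
    moreover have "map_poly of_int [:c:] = [:complex_of_int c:]"
      by (rule poly_eqI) (simp add: coeff_map_poly coeff_pCons split: nat.split)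
    ultimately show False using p by auto
  qed
  obtain q where q: "?P q"
    using assms by (auto elim: algebraicE')
  define p0 where "p0 = arg_min degree ?P"
  have p0: "?P p0" and min: "\<And>r. ?P r \<Longrightarrow> degree p0 \<le> degree r"
    using arg_min_nat_lemma[of ?P q degree] q unfolding p0_def by auto
  define p1 where "p1 = primitive_part p0"
  have p01: "p0 = [:content p0:] * p1" by (simp add: p1_def)
  have "?P p1"
  proof -
    have "poly (map_poly of_int [:content p0:]) \<alpha> \<noteq> 0"
      using posdeg[of "[:content p0:]"] p0 by auto
    moreover have "poly (map_poly of_int [:content p0:]) \<alpha> * poly (map_poly of_int p1) \<alpha> = 0"
      unfolding hom[symmetric] p01[symmetric] using p0 by simp
    ultimately show ?thesis using p0 unfolding p1_def by simp
  qed
  define p where "p = (if lead_coeff p1 > 0 then p1 else - p1)"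
  have p: "?P p"
    using \<open>?P p1\<close> unfolding p_def by (simp add: of_int_poly_hom.hom_uminus)
  have deg_p: "degree p = degree p0"
    unfolding p_def p1_def by simp
  have lc: "lead_coeff p > 0"
  proof -
    have "lead_coeff p1 \<noteq> 0" using \<open>?P p1\<close> by simp
    then show ?thesis unfolding p_def by (simp del: leading_coeff_0_iff)
  qed
  have cont: "content p = 1"
    using p0 content_smult[of "-1" p1] unfolding p_def p1_def by simp
  have irr: "irreducible p"
  proof (rule irreducibleI)
    show "p \<noteq> 0" using p by simp
    show "\<not> p dvd 1" using posdeg[OF p] by (simp add: poly_dvd_1)
    have unit: "b dvd 1" if "p = a * b" "?P a" for a b
    proof -
      from that p have "b \<noteq> 0" by auto
      with that have "degree p = degree a + degree b" by (simp add: degree_mult_eq)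
      with min[OF that(2)] deg_p have "degree b = 0" by simp
      then obtain c where c: "b = [:c:]" using degree_eq_zeroE by blast
      have "[:c:] dvd p" unfolding that(1) c by (rule dvd_triv_right)
      then have "c dvd content p" by (simp add: const_poly_dvd_iff_dvd_content)
      with cont c show ?thesis by (simp add: is_unit_const_poly_iff)
    qed
    fix a b assume ab: "p = a * b"
    with p hom[of a b] have "?P a \<or> ?P b" by auto
    with unit[of a b] unit[of b a] ab show "a dvd 1 \<or> b dvd 1"
      by (auto simp: mult.commute)
  qed
  have uniq: "r = p" if r: "irreducible r" "lead_coeff r > 0" "poly (map_poly of_int r) \<alpha> = 0"
    for r
  proof -
    obtain a s where as: "a \<noteq> 0" "smult a r = p * s + pseudo_mod r p"
      using pseudo_mod(1)[of p r] p by auto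
    have "poly (map_poly of_int (smult a r)) \<alpha> = 0"
      using r hom[of "[:a:]" r] by simp
    moreover have "poly (map_poly of_int (p * s)) \<alpha> = 0" using p hom by simp
    ultimately have "poly (map_poly of_int (pseudo_mod r p)) \<alpha> = 0"
      unfolding as by (simp add: of_int_poly_hom.hom_add)
    moreover have "pseudo_mod r p = 0 \<or> degree (pseudo_mod r p) < degree p0"
      using pseudo_mod(2)[of p r] p deg_p by auto
    ultimately have "pseudo_mod r p = 0" using min[of "pseudo_mod r p"] by linarith
    with as have "p dvd [:a:] * r" by simp
    moreover have "prime_elem p" using irr by (rule irreducible_imp_prime_elem)
    ultimately have "p dvd [:a:] \<or> p dvd r" by (simp only: prime_elem_dvd_mult_iff)
    moreover have "\<not> p dvd [:a:]"
      using dvd_imp_degree_le[of p "[:a:]"] as(1) posdeg[OF p] by auto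
    ultimately obtain c where c: "r = p * c" by auto
    with r irr have "c dvd 1" by (auto simp: irreducible_def)
    then obtain d where d: "c = [:d:]" "d dvd 1" by (auto simp: is_unit_poly_iff)
    have "d > 0"
    proof (rule ccontr)
      assume "\<not> d > 0"
      with d(2) have "d = - 1" by auto
      with c d(1) have "lead_coeff r = - lead_coeff p" by simp
      with r(2) lc show False by linarith
    qed
    with d(2) have "d = 1" by auto
    with c d(1) show ?thesis by simp
  qed
  show ?thesis
  proof (rule ex1I[of _ p])
    show "irreducible p \<and> lead_coeff p > 0 \<and> poly (map_poly of_int p) \<alpha> = 0"
      using irr lc p by blast
  qed (use uniq in blast)
qed

end

(* For real z one has 2 |z| |1 - z| |-1 - z| <= max 1 |z| ^ 4.  Multiplying over the roots of a
   totally real integer polynomial p of degree d and leading coefficient a gives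
   2^d |p(0) p(1) p(-1)| |a| <= M(p)^4.  If p does not vanish at 0, 1, -1, the values on the left
   are nonzero integers, so M(p)^4 >= 2^d and h >= (log 2) / 4, well above the required bound. *)
theory Submission
  imports Defs
begin

text \<open>For real \<open>z\<close> the product of the last two distances is
  \<open>|z^2 - 1|\<close> with \<open>z^2 = |z|^2\<close>, so both sides depend on
  \<open>y = |z|\<close> alone. At \<open>z = i\<close> the inequality fails, with 4 against 1. The
  exponent 3 would not do, since the left side grows like \<open>2 y^3\<close>.\<close>

lemma two_mult_roots_le_max_power4:
  assumes "z \<in> \<real>"
  shows "2 * (cmod (0 - z) * cmod (1 - z) * cmod (- 1 - z)) \<le> max 1 (cmod z) ^ 4"
proof -
  define y where "y = cmod z"
  have y0: "0 \<le> y" by (simp add: y_def)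
  from assms obtain r where r: "z = of_real r" by (auto elim: Reals_cases)
  have "cmod (1 - z) * cmod (- 1 - z) = cmod ((1 - z) * (- 1 - z))"
    by (simp only: norm_mult)
  also have "(1 - z) * (- 1 - z) = of_real (r\<^sup>2 - 1)"
    by (simp add: r algebra_simps power2_eq_square)
  also have "cmod \<dots> = \<bar>y\<^sup>2 - 1\<bar>"
    by (simp only: norm_of_real y_def r power2_abs)
  finally have eq: "cmod (1 - z) * cmod (- 1 - z) = \<bar>y\<^sup>2 - 1\<bar>" .
  have "2 * (y * \<bar>y\<^sup>2 - 1\<bar>) \<le> max 1 y ^ 4"
  proof (cases "y \<le> 1")
    case True
    \<comment> \<open>Expanded, this is \<open>4 y^3 - 4 y + 2\<close>, twice the difference
      \<open>1 - 2 y (1 - y^2)\<close>.\<close>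
    have "0 \<le> (y + 1) * (2 * y - 1)\<^sup>2 + (1 - y)" using y0 True by simp
    then have "2 * (y * (1 - y\<^sup>2)) \<le> 1"
      by (simp add: algebra_simps power2_eq_square)
    moreover have "y\<^sup>2 \<le> 1" using y0 True by (simp add: power_le_one)
    ultimately show ?thesis using True by (simp add: max_def abs_if)
  next
    case False
    \<comment> \<open>Expanded, this is exactly \<open>y^4 - 2 y (y^2 - 1)\<close>.\<close>
    have "0 \<le> (y\<^sup>2 - y - 1)\<^sup>2 + (y\<^sup>2 - 1)" using y0 False by simp
    then have "2 * (y * (y\<^sup>2 - 1)) \<le> y ^ 4"
      using False by (simp add: algebra_simps power2_eq_square power4_eq_xxxx)
    moreover have "1 \<le> y\<^sup>2" using False by simp
    then have "\<bar>y\<^sup>2 - 1\<bar> = y\<^sup>2 - 1" by simp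
    ultimately show ?thesis using False by (simp add: max_def)
  qed
  then show ?thesis by (simp only: eq mult.assoc) (simp add: y_def)
qed

lemma prod_list_mono_nonneg:
  fixes f g :: "'a \<Rightarrow> real"
  assumes "\<And>x. x \<in> set xs \<Longrightarrow> 0 \<le> f x \<and> f x \<le> g x"
  shows "(\<Prod>x\<leftarrow>xs. f x) \<le> (\<Prod>x\<leftarrow>xs. g x)"
proof -
  have "0 \<le> (\<Prod>x\<leftarrow>xs. f x) \<and> (\<Prod>x\<leftarrow>xs. f x) \<le> (\<Prod>x\<leftarrow>xs. g x)"
    using assms
  proof (induction xs)
    case (Cons x xs)
    have "0 \<le> f x" "f x \<le> g x" using Cons.prems by simp_all
    moreover have "0 \<le> (\<Prod>x\<leftarrow>xs. f x)" "(\<Prod>x\<leftarrow>xs. f x) \<le> (\<Prod>x\<leftarrow>xs. g x)"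
      using Cons.IH Cons.prems by simp_all
    ultimately show ?case by (simp add: mult_mono)
  qed simp
  then show ?thesis ..
qed

text \<open>The factorisation over the complex numbers, with multiplicities. It serves twice: at 0,
  1 and -1 it turns integer values into products of distances, and at a listed root it shows that
  the polynomial vanishes there.\<close>

lemma cmod_poly_eq_prod_roots:
  "cmod (poly (map_poly of_int p) x) =
    \<bar>real_of_int (lead_coeff p)\<bar> * (\<Prod>z\<leftarrow>complex_roots_int p. cmod (x - z))"
proof -
  have prod: "cmod (poly (\<Prod>z\<leftarrow>zs. [:- z, 1:]) x) = (\<Prod>z\<leftarrow>zs. cmod (x - z))" for zs
    by (induction zs) (simp_all only: list.map prod_list.Nil prod_list.Cons poly_mult norm_mult, simp_all)
  show ?thesis
    unfolding complex_roots_int(1)[of p, symmetric] by (simp only: poly_smult norm_mult prod norm_of_int)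
qed

lemma mahler_measure_power4_ge:
  fixes p :: "int poly"
  assumes real: "\<And>z :: complex. poly (map_poly of_int p) z = 0 \<Longrightarrow> z \<in> \<real>"
    and nz: "poly p 0 \<noteq> 0" "poly p 1 \<noteq> 0" "poly p (- 1) \<noteq> 0"
  shows "2 ^ degree p \<le> mahler_measure p ^ 4"
proof -
  define zs where "zs = complex_roots_int p"
  define a where "a = \<bar>real_of_int (lead_coeff p)\<bar>"
  have "p \<noteq> 0" using nz by auto
  then have "lead_coeff p \<noteq> 0" by simp
  then have "1 \<le> \<bar>lead_coeff p\<bar>" by linarith
  then have a: "1 \<le> a" unfolding a_def by linarith
  have val: "1 \<le> a * (\<Prod>z\<leftarrow>zs. cmod (of_int k - z))" if "poly p k \<noteq> 0" for k
  proof -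
    have "1 \<le> \<bar>poly p k\<bar>" using that by linarith
    then have "1 \<le> cmod (of_int (poly p k))"
      unfolding norm_of_int by linarith
    also have "of_int (poly p k) = poly (map_poly of_int p) (of_int k :: complex)"
      by simp
    finally show ?thesis
      by (simp only: cmod_poly_eq_prod_roots a_def zs_def)
  qed
  have zs_real: "z \<in> \<real>" if "z \<in> set zs" for z
  proof -
    \<comment> \<open>The factor \<open>w = z\<close> kills the product, so \<open>z\<close> is a
      root of \<open>p\<close> and the hypothesis \<open>real\<close> applies.\<close>
    have "cmod (z - z) \<in> set (map (\<lambda>w. cmod (z - w)) zs)"
      using that by (metis image_eqI set_map)
    then have "(\<Prod>w\<leftarrow>zs. cmod (z - w)) = 0" by (simp add: prod_list_zero_iff)
    then have "cmod (poly (map_poly of_int p) z) = 0"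
      by (simp add: cmod_poly_eq_prod_roots zs_def)
    then show ?thesis by (intro real) simp
  qed
  have mm: "mahler_measure p = a * (\<Prod>z\<leftarrow>zs. max 1 (cmod z))"
    by (simp add: mahler_measure_def mahler_measure_poly_def a_def zs_def complex_roots_int_def)
  let ?P = "\<lambda>x. \<Prod>z\<leftarrow>zs. cmod (x - z)"
  have "1 * 1 \<le> (a * ?P 0) * (a * ?P 1)"
    using val[of 0] val[of 1] nz by (intro mult_mono) simp_all
  then have "1 * 1 \<le> ((a * ?P 0) * (a * ?P 1)) * (a * ?P (- 1))"
    using val[of "- 1"] nz by (intro mult_mono) simp_all
  \<comment> \<open>The three values supply only \<open>a^3\<close>; one more factor
    \<open>a\<close>, which is at least 1, completes the \<open>a^4\<close> contained in the fourth
    power of the Mahler measure.\<close>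
  with a have "1 * 1 \<le> a * (((a * ?P 0) * (a * ?P 1)) * (a * ?P (- 1)))"
    by (intro mult_mono) simp_all
  also have "\<dots> = a ^ 4 * (?P 0 * ?P 1 * ?P (- 1))"
    by (simp add: power4_eq_xxxx)
  \<comment> \<open>One factor 2 is handed to each root, so that the pointwise inequality applies
    root by root; the length of \<open>zs\<close> is the degree of \<open>p\<close>.\<close>
  finally have "2 ^ length zs * 1 \<le> 2 ^ length zs * (a ^ 4 * (?P 0 * ?P 1 * ?P (- 1)))"
    by (intro mult_left_mono) simp_all
  also have "\<dots> = a ^ 4 * (2 ^ length zs * (?P 0 * ?P 1 * ?P (- 1)))"
    by simp
  also have "2 ^ length zs * (?P 0 * ?P 1 * ?P (- 1)) =
      (\<Prod>z\<leftarrow>zs. 2 * (cmod (0 - z) * cmod (1 - z) * cmod (- 1 - z)))"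
    by (induction zs) (simp_all add: mult_ac)
  also have "a ^ 4 * \<dots> \<le> a ^ 4 * (\<Prod>z\<leftarrow>zs. max 1 (cmod z) ^ 4)"
    using two_mult_roots_le_max_power4[OF zs_real]
    by (intro mult_left_mono prod_list_mono_nonneg) simp_all
  also have "(\<Prod>z\<leftarrow>zs. max 1 (cmod z) ^ 4) = (\<Prod>z\<leftarrow>zs. max 1 (cmod z)) ^ 4"
    by (induction zs) (simp_all add: power_mult_distrib)
  finally show ?thesis
    by (simp add: mm power_mult_distrib zs_def complex_roots_int(2))
qed

lemma min_int_poly:
  assumes "algebraic \<alpha>"
  shows "irreducible (min_int_poly \<alpha>)" "lead_coeff (min_int_poly \<alpha>) > 0"
    "poly (map_poly of_int (min_int_poly \<alpha>)) \<alpha> = 0"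
  using theI'[OF min_int_poly_ex1[OF assms]] unfolding min_int_poly_def by auto

text \<open>An integer root \<open>k\<close> splits off the factor \<open>X - k\<close>, and
  irreducibility makes the cofactor a unit, hence a nonzero constant. This turns the exclusion of 0,
  1 and -1 as values of \<alpha> into nonvanishing of its minimal polynomial at these
  points.\<close>

lemma irreducible_int_poly_root_unique:
  fixes p :: "int poly" and \<alpha> :: complex
  assumes irr: "irreducible p" and root: "poly p k = 0"
    and \<alpha>: "poly (map_poly of_int p) \<alpha> = 0"
  shows "\<alpha> = of_int k"
proof -
  from root obtain c where c: "p = [:- k, 1:] * c"
    by (auto simp: poly_eq_0_iff_dvd elim: dvdE)
  have "\<not> [:- k, 1:] dvd 1" by (simp add: poly_dvd_1)
  with irreducibleD[OF irr c] have "c dvd 1" by blast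
  then obtain d where d: "c = [:d:]" "d dvd 1" by (auto simp: is_unit_poly_iff)
  have "poly (map_poly of_int [:d:]) \<alpha> = of_int d"
  proof -
    have "map_poly of_int [:d:] = [:complex_of_int d:]"
      by (rule poly_eqI) (simp add: coeff_map_poly coeff_pCons split: nat.split)
    then show ?thesis by simp
  qed
  moreover have "poly (map_poly of_int [:- k, 1:]) \<alpha> = \<alpha> - of_int k"
    by simp
  ultimately have "poly (map_poly of_int p) \<alpha> = (\<alpha> - of_int k) * of_int d"
    by (simp only: c d(1) of_int_poly_hom.hom_mult poly_mult)
  with \<alpha> d(2) show ?thesis by auto
qed

text \<open>Logarithms are taken in \<open>2^d <= M(p)^4\<close>, where \<open>p\<close> is the
  minimal polynomial and \<open>d\<close> its degree; dividing by \<open>4 d\<close> gives the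
  bound.\<close>

lemma weil_height_ge:
  assumes "\<alpha> \<in> Q_tr" "\<alpha> \<noteq> 0" "\<alpha> \<noteq> 1" "\<alpha> \<noteq> - 1"
  shows "ln 2 / 4 \<le> weil_height \<alpha>"
proof -
  define p where "p = min_int_poly \<alpha>"
  have alg: "algebraic \<alpha>" and conj: "galois_conjugates \<alpha> \<subseteq> \<real>"
    using assms(1) by (auto simp: Q_tr_def)
  note p = min_int_poly[OF alg, folded p_def]
  have nz: "poly p k \<noteq> 0" if "\<alpha> \<noteq> of_int k" for k
    using irreducible_int_poly_root_unique[OF p(1) _ p(3)] that by blast
  have deg: "degree p > 0"
  proof (rule ccontr)
    assume "\<not> degree p > 0"
    then obtain c where "p = [:c:]" using degree_eq_zeroE by blast
    with p(2,3) show False by simp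
  qed
  have ge: "2 ^ degree p \<le> mahler_measure p ^ 4"
    using nz[of 0] nz[of 1] nz[of "- 1"] assms(2-) conj
    by (intro mahler_measure_power4_ge) (auto simp: galois_conjugates_def p_def)
  have pos: "0 < mahler_measure p"
  proof -
    have "mahler_measure p \<noteq> 0"
    proof
      assume "mahler_measure p = 0"
      with ge have "(2 :: real) ^ degree p \<le> 0" by simp
      moreover have "(0 :: real) < 2 ^ degree p" by simp
      ultimately show False by linarith
    qed
    with mahler_measure_ge_0[of p] show ?thesis by simp
  qed
  have "real (degree p) * ln 2 = ln (2 ^ degree p)" by (simp add: ln_realpow)
  also have "\<dots> \<le> ln (mahler_measure p ^ 4)" using ge pos by simp
  also have "\<dots> = 4 * ln (mahler_measure p)" using pos by (simp add: ln_realpow)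
  finally show ?thesis
    using deg unfolding weil_height_def p_def[symmetric] by (simp add: field_simps)
qed

text \<open>The function \<open>-1 + t + t^31\<close> increases for positive \<open>t\<close> and
  changes sign between the two decimals.\<close>

lemma theta31_bounds: "0.921277 < theta31" "theta31 < 0.921278"
proof -
  have th: "0 < theta31" "theta31 < 1" "- 1 + theta31 + theta31 ^ 31 = 0"
    using theI'[OF theta31_ex1] unfolding theta31_def by auto
  show "0.921277 < theta31"
  proof (rule ccontr)
    assume "\<not> 0.921277 < theta31"
    then have le: "theta31 \<le> 0.921277" by simp
    then have "theta31 ^ 31 \<le> 0.921277 ^ 31" using th(1) by (intro power_mono) simp_all
    moreover have "- 1 + 0.921277 + 0.921277 ^ 31 < (0 :: real)"
      by (simp add: field_simps)
    ultimately show False using th(3) le by linarith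
  qed
  show "theta31 < 0.921278"
  proof (rule ccontr)
    assume "\<not> theta31 < 0.921278"
    then have le: "0.921278 \<le> theta31" by simp
    then have "0.921278 ^ 31 \<le> theta31 ^ 31" by (intro power_mono) simp_all
    moreover have "- 1 + 0.921278 + 0.921278 ^ 31 > (0 :: real)"
      by (simp add: field_simps)
    ultimately show False using th(3) le by linarith
  qed
qed

text \<open>The constants are 4 times 0.020498 and 4 times 0.020499. Each bound compares a Taylor
  polynomial of \<open>exp\<close> with a decimal bound for \<open>theta31\<close>.\<close>

lemma ln_inverse_theta31_bounds:
  "0.081992 \<le> ln (inverse theta31)" "ln (inverse theta31) < 0.081996"
proof -
  have pos: "0 < theta31" using theta31_bounds by simp
  have ln: "ln (inverse theta31) = - ln theta31" using pos by (simp add: ln_inverse)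
  obtain t where t: "exp (- 0.081992 :: real) =
      (\<Sum>m<6. (- 0.081992) ^ m / fact m) + (exp t / fact 6) * (- 0.081992) ^ 6"
    using Maclaurin_exp_le[of "- 0.081992" 6] by blast
  have "theta31 < 0.921278" by (rule theta31_bounds)
  also have "(0.921278 :: real) \<le> (\<Sum>m<6. (- 0.081992) ^ m / fact m)"
    by (simp add: eval_nat_numeral fact_numeral field_simps)
  \<comment> \<open>The remainder has even order 6, so it is nonnegative and the partial sum lies
    below \<open>exp\<close>.\<close>
  also have "\<dots> \<le> exp (- 0.081992)" unfolding t by simp
  finally have "ln theta31 \<le> - 0.081992"
    using pos by (metis less_eq_real_def ln_exp ln_less_cancel_iff exp_gt_zero)
  then show "0.081992 \<le> ln (inverse theta31)" unfolding ln by simp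
  obtain s where s: "exp (- 0.081996 :: real) =
      (\<Sum>m<5. (- 0.081996) ^ m / fact m) + (exp s / fact 5) * (- 0.081996) ^ 5"
    using Maclaurin_exp_le[of "- 0.081996" 5] by blast
  \<comment> \<open>Here the remainder has odd order 5 at a negative argument, so the partial sum
    lies above \<open>exp\<close>.\<close>
  have "exp (- 0.081996 :: real) \<le> (\<Sum>m<5. (- 0.081996) ^ m / fact m)"
    unfolding s by simp
  also have "\<dots> \<le> 0.921277"
    by (simp add: eval_nat_numeral fact_numeral field_simps)
  also have "0.921277 < theta31" by (rule theta31_bounds)
  finally have "- 0.081996 < ln theta31"
    using pos by (metis ln_exp ln_less_cancel_iff exp_gt_zero)
  then show "ln (inverse theta31) < 0.081996" unfolding ln by simp
qed

theorem theorem1p9: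
  shows "(\<forall>\<alpha> \<in> Q_tr. \<alpha> \<noteq> 0 \<and> \<alpha> \<noteq> 1 \<and> \<alpha> \<noteq> - 1 \<longrightarrow>
            weil_height \<alpha> > 1 / 4 * ln (inverse theta31))
       \<and> 0.020498 \<le> 1 / 4 * ln (inverse theta31)
       \<and> 1 / 4 * ln (inverse theta31) < 0.020499"
proof (intro conjI ballI impI)
  fix \<alpha> assume "\<alpha> \<in> Q_tr" "\<alpha> \<noteq> 0 \<and> \<alpha> \<noteq> 1 \<and> \<alpha> \<noteq> - 1"
  then have "ln 2 / 4 \<le> weil_height \<alpha>" by (intro weil_height_ge) auto
  \<comment> \<open>From \<open>ln (1 + x) <= x\<close> at \<open>x = -1/2\<close>. The height is
    thus at least 1/8, far above 0.020499.\<close>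
  moreover have "1 / 2 \<le> ln (2 :: real)"
    using ln_add_one_self_le_self2[of "- 1 / 2"] by (simp add: ln_div)
  ultimately show "1 / 4 * ln (inverse theta31) < weil_height \<alpha>"
    using ln_inverse_theta31_bounds(2) by simp
qed (use ln_inverse_theta31_bounds in simp_all)

end
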